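(* Assume $\eta>0$ (duality condition), that the nonzero eigenvalues $b_1,\dots,b_{N_R}$ of $\alpha^{-1}R$ (counted with multiplicity) are pairwise distinct, and that the nonzero eigenvalues $b_1^\flat,\dots,b_{N_R}^\flat$ of $\eta^{-1}R$ (counted with multiplicity) are pairwise distinct. Index the low-loss eigenvalues of $A(\beta)$ so that $\rho_j=0$ for $N_R+1\le j\le 2N_R$ and $\rho_j\ne0$ for $2N_R+1\le j\le 2N$. Then for all sufficiently large $\beta$: $$\operatorname{Re}\zeta_j(\beta)=0\quad(1\le j\le N_R),\qquad \operatorname{Re}\zeta_j(\beta)=0\quad(N_R+1\le j\le 2N_R),\qquad \operatorname{Re}\zeta_j(\beta)\ne0\quad(2N_R+1\le j\le 2N).$$
   Context: Setting. $N\ge 1$; $\alpha,\eta,\theta,R$ are real $N\times N$ matrices with $\alpha^{\mathrm T}=\alpha>0$, $\eta^{\mathrm T}=\eta\ge0$, $\theta^{\mathrm T}=-\theta$, $R^{\mathrm T}=R\ge0$, and $N_R=\operatorname{rank}R>0$. $\beta\ge0$ is the loss parameter. $\sqrt{\cdot}$ denotes the positive semidefinite square root. On $H=\mathbb C^{2N}=\mathbb C^N\oplus\mathbb C^N$ (standard inner product) set $$\Omega=\begin{bmatrix}-2\mathrm i\sqrt\alpha^{-1}\theta\sqrt\alpha^{-1} & -\mathrm i\Phi^{\mathrm T}\\ \mathrm i\Phi&0\end{bmatrix},\quad \Phi=\sqrt\eta\sqrt\alpha^{-1},\quad B=\begin{bmatrix}\sqrt\alpha^{-1}R\sqrt\alpha^{-1}&0\\0&0\end{bmatrix},\quad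 A(\beta)=\Omega-\mathrm i\beta B$$ ($\Omega$ is Hermitian, $B\ge0$, $\operatorname{rank}B=N_R$). The nonzero eigenvalues of $B$ with multiplicity are those of $\alpha^{-1}R$, written $0<b_1\le\dots\le b_{N_R}$. $P_B^\perp$ is the orthogonal projection onto $\operatorname{Ker}B$, and $\Omega_1=P_B^\perp\Omega P_B^\perp|_{\operatorname{Ker}B}$. High-loss and low-loss eigenvalues (known facts). There is an orthonormal basis $\{\mathring w_j\}_{j=1}^{2N}$ of $H$ with $B\mathring w_j=b_j\mathring w_j$ for $1\le j\le N_R$, and $\mathring w_j\in\operatorname{Ker}B$, $\Omega_1\mathring w_j=\rho_j\mathring w_j$ for $N_R+1\le j\le 2N$, such that for all sufficiently large $\beta$ the operator $A(\beta)$ has a basis of eigenvectors $w_j(\beta)$, $A(\beta)w_j(\beta)=\zeta_j(\beta)w_j(\beta)$, $1\le j\le 2N$, where all $w_j(\beta)=\mathring w_j+O(\beta^{-1})$ are given by convergent power series in $\beta^{-1}$, and: (high-loss, $1\le j\le N_R$) $\zeta_j(\beta)=-\mathrm i b_j\beta+\rho_j+O(\beta^{-1})$ is a convergent Laurent series in $\beta^{-1}$ with a simple pole at $\beta^{-1}=0$; (low-loss, $N_R+1\le j\le 2N$) $\zeta_j(\beta)=\rho_j-\mathrm i d_j\beta^{-1}+O(\beta^{-2})$ is a convergent power series in $\beta^{-1}$, $d_j\ge0$. If $\operatorname{Ker}R\cap\operatorname{Ker}\eta=\{0\}$ (in particular if $\eta>0$), then exactly $N_R$ of the numbers $\rho_j$,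 $N_R+1\le j\le 2N$, are zero. *)

theory Defs
  imports "HOL-Analysis.Analysis" "HOL-Computational_Algebra.Polynomial"
begin

definition pos_semidef :: "real^'n^'n \<Rightarrow> bool" where
  "pos_semidef M \<longleftrightarrow> (\<forall>x. 0 \<le> x \<bullet> (M *v x))"

definition pos_def :: "real^'n^'n \<Rightarrow> bool" where
  "pos_def M \<longleftrightarrow> (\<forall>x. x \<noteq> 0 \<longrightarrow> 0 < x \<bullet> (M *v x))"

text \<open>The description below determines a unique matrix when the argument is symmetric and
  positive semidefinite; the square root is meaningful only for such arguments.\<close>

definition msqrt :: "real^'n^'n \<Rightarrow> real^'n^'n" where
  "msqrt M = (THE S. transpose S = S \<and> pos_semidef S \<and> S ** S = M)"

definition charpoly :: "('a::comm_ring_1)^'n^'n \<Rightarrow> 'a poly" where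
  "charpoly M = det (\<chi> i j. (if i = j then [:0, 1:] else 0) - [:M $ i $ j:])"

definition complexify :: "real^'n^'m \<Rightarrow> complex^'n^'m" where
  "complexify = map_matrix complex_of_real"

text \<open>\<open>b 1, \<dots>, b n\<close> lists the nonzero complex eigenvalues of \<open>M\<close>,
  each repeated according to its algebraic multiplicity.\<close>

definition nonzero_eigenvalues :: "real^'n^'n \<Rightarrow> nat \<Rightarrow> (nat \<Rightarrow> real) \<Rightarrow> bool" where
  "nonzero_eigenvalues M n b \<longleftrightarrow>
     (\<forall>j\<in>{1..n}. b j \<noteq> 0) \<and>
     (\<forall>z. z \<noteq> 0 \<longrightarrow>
        card {j\<in>{1..n}. complex_of_real (b j) = z} = order z (charpoly (complexify M)))"

definition block_matrix ::
  "'a^'n^'n \<Rightarrow> 'a^'n^'n \<Rightarrow> 'a^'n^'n \<Rightarrow> 'a^'n^'n \<Rightarrow> 'a^('n + 'n)^('n + 'n)" where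
  "block_matrix P Q S T = (\<chi> i j.
     case i of
       Inl k \<Rightarrow> (case j of Inl l \<Rightarrow> P $ k $ l | Inr l \<Rightarrow> Q $ k $ l)
     | Inr k \<Rightarrow> (case j of Inl l \<Rightarrow> S $ k $ l | Inr l \<Rightarrow> T $ k $ l))"

definition cmat_scale :: "complex \<Rightarrow> complex^'n^'m \<Rightarrow> complex^'n^'m" where
  "cmat_scale c = map_matrix ((*) c)"

definition Phi_mat :: "real^'n^'n \<Rightarrow> real^'n^'n \<Rightarrow> real^'n^'n" where
  "Phi_mat \<alpha> \<eta> = msqrt \<eta> ** matrix_inv (msqrt \<alpha>)"

definition Omega_mat ::
  "real^'n^'n \<Rightarrow> real^'n^'n \<Rightarrow> real^'n^'n \<Rightarrow> complex^('n + 'n)^('n + 'n)" where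
  "Omega_mat \<alpha> \<eta> \<theta> = block_matrix
     (cmat_scale (- 2 * \<i>) (complexify (matrix_inv (msqrt \<alpha>) ** \<theta> ** matrix_inv (msqrt \<alpha>))))
     (cmat_scale (- \<i>) (complexify (transpose (Phi_mat \<alpha> \<eta>))))
     (cmat_scale \<i> (complexify (Phi_mat \<alpha> \<eta>)))
     0"

definition B_mat :: "real^'n^'n \<Rightarrow> real^'n^'n \<Rightarrow> complex^('n + 'n)^('n + 'n)" where
  "B_mat \<alpha> R = block_matrix
     (complexify (matrix_inv (msqrt \<alpha>) ** R ** matrix_inv (msqrt \<alpha>))) 0 0 0"

definition A_mat ::
  "real^'n^'n \<Rightarrow> real^'n^'n \<Rightarrow> real^'n^'n \<Rightarrow> real^'n^'n \<Rightarrow> real \<Rightarrow>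
     complex^('n + 'n)^('n + 'n)" where
  "A_mat \<alpha> \<eta> \<theta> R \<beta> =
     Omega_mat \<alpha> \<eta> \<theta> - cmat_scale (\<i> * complex_of_real \<beta>) (B_mat \<alpha> R)"

text \<open>The library inner product on \<^typ>\<open>complex^'n\<close> is the real part of the
  Hermitian one, so the latter is introduced separately.\<close>

definition hinner :: "complex^'n \<Rightarrow> complex^'n \<Rightarrow> complex" where
  "hinner x y = (\<Sum>i\<in>UNIV. cnj (x $ i) * y $ i)"

definition mker :: "complex^'n^'m \<Rightarrow> (complex^'n) set" where
  "mker M = {x. M *v x = 0}"

definition orth_proj :: "(complex^'n) set \<Rightarrow> complex^'n \<Rightarrow> complex^'n" where
  "orth_proj S x = (THE y. y \<in> S \<and> (\<forall>z\<in>S. hinner z (x - y) = 0))"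

text \<open>To be applied to vectors of \<^term>\<open>mker (B_mat \<alpha> R)\<close> only.\<close>

definition Omega1 ::
  "real^'n^'n \<Rightarrow> real^'n^'n \<Rightarrow> real^'n^'n \<Rightarrow> real^'n^'n \<Rightarrow>
     complex^('n + 'n) \<Rightarrow> complex^('n + 'n)" where
  "Omega1 \<alpha> \<eta> \<theta> R x =
     orth_proj (mker (B_mat \<alpha> R)) (Omega_mat \<alpha> \<eta> \<theta> *v orth_proj (mker (B_mat \<alpha> R)) x)"

definition basis_family :: "nat set \<Rightarrow> (nat \<Rightarrow> complex^'n) \<Rightarrow> bool" where
  "basis_family I v \<longleftrightarrow> inj_on v I \<and> vec.independent (v ` I) \<and> vec.span (v ` I) = UNIV"

definition orthonormal_basis :: "nat set \<Rightarrow> (nat \<Rightarrow> complex^'n) \<Rightarrow> bool" where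
  "orthonormal_basis I v \<longleftrightarrow>
     basis_family I v \<and> (\<forall>j\<in>I. \<forall>k\<in>I. hinner (v j) (v k) = (if j = k then 1 else 0))"

text \<open>\<open>f\<close> is, for all large arguments, the sum of the convergent power series
  in \<open>1 / \<beta>\<close> with coefficients \<open>c\<close>. In particular \<open>f \<beta> = c 0 + O(1 / \<beta>)\<close> and
  \<open>f \<beta> = c 0 + c 1 / \<beta> + O((1 / \<beta>)\<^sup>2)\<close>, which is how the asymptotic expansions are expressed below.\<close>

definition inverse_power_series :: "(real \<Rightarrow> 'a::real_normed_vector) \<Rightarrow> (nat \<Rightarrow> 'a) \<Rightarrow> bool" where
  "inverse_power_series f c \<longleftrightarrow>
     (\<forall>\<^sub>F \<beta> in at_top. (\<lambda>n. (1 / \<beta>) ^ n *\<^sub>R c n) sums f \<beta>)"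

text \<open>High-loss eigenvalues are those with index at most \<open>rank R\<close>, low-loss
  eigenvalues the remaining ones; \<open>w0\<close> is the limit of the eigenbasis \<open>w\<close> as
  \<open>\<beta> \<rightarrow> \<infinity>\<close>. The Laurent series of a high-loss eigenvalue is written as its polar part
  \<open>- \<i> b\<^sub>j \<beta>\<close> plus a power series in \<open>1 / \<beta>\<close>. The numbers \<open>d j\<close> matter for low-loss
  indices only.\<close>

definition loss_eigensystem ::
  "real^'n^'n \<Rightarrow> real^'n^'n \<Rightarrow> real^'n^'n \<Rightarrow> real^'n^'n \<Rightarrow>
     (nat \<Rightarrow> real) \<Rightarrow> (nat \<Rightarrow> real) \<Rightarrow> (nat \<Rightarrow> real) \<Rightarrow> (nat \<Rightarrow> complex^('n + 'n)) \<Rightarrow>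
     (nat \<Rightarrow> real \<Rightarrow> complex^('n + 'n)) \<Rightarrow> (nat \<Rightarrow> real \<Rightarrow> complex) \<Rightarrow> bool" where
  "loss_eigensystem \<alpha> \<eta> \<theta> R b \<rho> d w0 w \<zeta> \<longleftrightarrow>
     orthonormal_basis {1..2 * CARD('n)} w0 \<and>
     (\<forall>j\<in>{1..rank R}. B_mat \<alpha> R *v w0 j = complex_of_real (b j) *s w0 j) \<and>
     (\<forall>j\<in>{rank R + 1..2 * CARD('n)}.
        w0 j \<in> mker (B_mat \<alpha> R) \<and>
        Omega1 \<alpha> \<eta> \<theta> R (w0 j) = complex_of_real (\<rho> j) *s w0 j) \<and>
     (\<forall>\<^sub>F \<beta> in at_top.
        basis_family {1..2 * CARD('n)} (\<lambda>j. w j \<beta>) \<and>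
        (\<forall>j\<in>{1..2 * CARD('n)}. A_mat \<alpha> \<eta> \<theta> R \<beta> *v w j \<beta> = \<zeta> j \<beta> *s w j \<beta>)) \<and>
     (\<forall>j\<in>{1..2 * CARD('n)}. \<exists>c. inverse_power_series (w j) c \<and> c 0 = w0 j) \<and>
     (\<forall>j\<in>{1..rank R}. \<exists>c.
        inverse_power_series (\<lambda>\<beta>. \<zeta> j \<beta> + \<i> * complex_of_real (b j * \<beta>)) c \<and>
        c 0 = complex_of_real (\<rho> j)) \<and>
     (\<forall>j\<in>{rank R + 1..2 * CARD('n)}. 0 \<le> d j \<and> (\<exists>c.
        inverse_power_series (\<zeta> j) c \<and>
        c 0 = complex_of_real (\<rho> j) \<and> c 1 = - \<i> * complex_of_real (d j)))"

end

theory Submission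
  imports Defs
begin

text \<open>The entries of \<open>A(\<beta>)\<close> are purely imaginary, so its spectrum is invariant under the
  reflection \<open>z \<mapsto> - cnj z\<close>. A branch \<open>\<zeta>\<^sub>j\<close> whose leading coefficient is purely imaginary and
  different from that of every other branch is therefore mapped to itself, hence purely
  imaginary. For the high-loss branches the coefficients are the distinct numbers \<open>- \<i> b\<^sub>j\<close>. For the
  low-loss branches with \<open>\<rho>\<^sub>j = 0\<close> they are \<open>- \<i> d\<^sub>j\<close>, and letting \<open>\<beta> \<rightarrow> \<infinity>\<close> in the block form of the eigenvalue equation
  yields independent vectors \<open>q\<^sub>j\<close> with \<open>\<eta> q\<^sub>j = d\<^sub>j R q\<^sub>j\<close>. If two of the \<open>d\<^sub>j\<close> agreed, \<open>1 / d\<^sub>j\<close> would be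
  a multiple eigenvalue of \<open>\<eta>\<^sup>-\<^sup>1 R\<close>.\<close>

subsection \<open>Square roots of positive definite matrices\<close>

lemma inner_matrix_vector_transpose:
  fixes A :: "real^'n^'m"
  shows "(A *v x) \<bullet> y = x \<bullet> (transpose A *v y)"
  by (metis dot_lmul_matrix inner_commute vector_transpose_matrix transpose_transpose)

lemma symmetric_matrixI:
  fixes S :: "real^'n^'n"
  assumes "\<And>x y. (S *v x) \<bullet> y = x \<bullet> (S *v y)"
  shows "transpose S = S"
proof -
  have "transpose S *v y = S *v y" for y
  proof -
    have "x \<bullet> (transpose S *v y) = x \<bullet> (S *v y)" for x
      using assms[of x y] inner_matrix_vector_transpose[of S x y] by simp
    then show ?thesis by (metis vector_eq_rdot inner_commute)
  qed
  then show ?thesis by (simp add: matrix_eq)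
qed

text \<open>For symmetric \<open>D\<close> the \<open>i\<close>-th diagonal entry of
  \<open>D ** S ** D\<close> is the quadratic form of \<open>S\<close> at
  \<open>D *v axis i 1\<close>. The trace thus inherits the sign of the form.\<close>

lemma trace_congruence:
  fixes D S :: "real^'n^'n"
  assumes "transpose D = D"
  shows "trace (D ** S ** D) = (\<Sum>i\<in>UNIV. (D *v axis i 1) \<bullet> (S *v (D *v axis i 1)))"
proof -
  have "(D ** S ** D) $ i $ i = (D *v axis i 1) \<bullet> (S *v (D *v axis i 1))" for i
  proof -
    have "(D *v axis i 1) \<bullet> (S *v (D *v axis i 1)) = axis i 1 \<bullet> (D *v (S *v (D *v axis i 1)))"
      using inner_matrix_vector_transpose[of D] assms by simp
    also have "\<dots> = axis i 1 \<bullet> ((D ** S ** D) *v axis i 1)"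
      by (simp add: matrix_vector_mul_assoc matrix_mul_assoc)
    also have "\<dots> = (D ** S ** D) $ i $ i"
      by (simp add: inner_axis' matrix_vector_mult_basis column_def)
    finally show ?thesis by simp
  qed
  then show ?thesis by (simp add: trace_def)
qed

text \<open>With \<open>D = S - T\<close> one has \<open>S D = - D T\<close>, so the traces of \<open>D S D\<close> and \<open>D T D\<close>
  cancel although both are nonnegative.\<close>

lemma square_root_unique:
  fixes S T :: "real^'n^'n"
  assumes S: "transpose S = S" "pos_def S"
    and T: "transpose T = T" "pos_semidef T"
    and eq: "S ** S = T ** T"
  shows "S = T"
proof -
  define D where "D = S - T"
  have D: "transpose D = D"
    using S(1) T(1) by (simp add: D_def transpose_def vec_eq_iff)
  have SD: "S ** D = - (D ** T)"
    unfolding matrix_eq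
  proof
    fix x
    have "S *v (S *v x) = T *v (T *v x)"
      by (simp add: matrix_vector_mul_assoc eq)
    then show "(S ** D) *v x = (- (D ** T)) *v x"
      using matrix_vector_mult_diff_rdistrib[of 0 "D ** T" x]
      by (simp add: D_def matrix_vector_mul_assoc[symmetric] matrix_vector_mult_diff_distrib
          matrix_vector_mult_diff_rdistrib)
  qed
  have "trace (D ** S ** D) = trace (D ** - (D ** T))"
    by (simp add: matrix_mul_assoc[symmetric] SD)
  also have "\<dots> = - trace (D ** (D ** T))"
    by (simp add: trace_def matrix_matrix_mult_def sum_negf)
  also have "trace (D ** (D ** T)) = trace (D ** T ** D)"
    by (rule trace_mul_sym)
  finally have "(\<Sum>i\<in>UNIV. (D *v axis i 1) \<bullet> (S *v (D *v axis i 1)))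
      = - (\<Sum>i\<in>UNIV. (D *v axis i 1) \<bullet> (T *v (D *v axis i 1)))"
    by (simp add: trace_congruence D)
  moreover have "0 \<le> (\<Sum>i\<in>UNIV. (D *v axis i 1) \<bullet> (T *v (D *v axis i 1)))"
    using T(2) by (intro sum_nonneg) (simp add: pos_semidef_def)
  moreover have nn: "0 \<le> x \<bullet> (S *v x)" for x
    using S(2) by (cases "x = 0") (auto simp: pos_def_def less_imp_le)
  then have "0 \<le> (\<Sum>i\<in>UNIV. (D *v axis i 1) \<bullet> (S *v (D *v axis i 1)))"
    by (intro sum_nonneg) simp
  ultimately have "(\<Sum>i\<in>UNIV. (D *v axis i 1) \<bullet> (S *v (D *v axis i 1))) = 0"
    by linarith
  \<comment> \<open>A vanishing sum of nonnegative terms has only vanishing terms; definiteness of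
    \<open>S\<close> then annihilates every column of \<open>D\<close>.\<close>
  then have "(D *v axis i 1) \<bullet> (S *v (D *v axis i 1)) = 0" for i
    using nn by (simp add: sum_nonneg_eq_0_iff)
  then have "D *v axis i 1 = 0" for i
    using S(2) unfolding pos_def_def by (metis less_irrefl)
  then have "column i D = 0" for i
    by (simp add: matrix_vector_mult_basis)
  then have "D = 0"
    by (simp add: column_def vec_eq_iff)
  then show ?thesis by (simp add: D_def)
qed

text \<open>The form attains a minimum on the compact unit sphere, which definiteness makes
  positive; homogeneity of degree two extends the bound to all vectors.\<close>

lemma pos_def_lower_bound:
  fixes M :: "real^'n^'n"
  assumes "pos_def M"
  obtains m where "0 < m" "\<And>x. m * (norm x)\<^sup>2 \<le> x \<bullet> (M *v x)"
proof -
  let ?f = "\<lambda>x. x \<bullet> (M *v x)"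
  have "continuous_on (sphere 0 1) ?f"
    by (intro continuous_intros matrix_vector_mult_linear_continuous_on)
  moreover have "sphere (0::real^'n) 1 \<noteq> {}" by simp
  ultimately have "\<exists>u\<in>sphere 0 1. \<forall>x\<in>sphere 0 1. ?f u \<le> ?f x"
    by (intro continuous_attains_inf compact_sphere)
  then obtain u where u: "u \<in> sphere 0 1" "\<And>x. x \<in> sphere 0 1 \<Longrightarrow> ?f u \<le> ?f x"
    by blast
  show thesis
  proof
    have "u \<noteq> 0" using u(1) by auto
    then show "0 < ?f u" using assms unfolding pos_def_def by blast
    fix x :: "real^'n"
    show "?f u * (norm x)\<^sup>2 \<le> ?f x"
    proof (cases "x = 0")
      case False
      then have "?f u \<le> ?f (x /\<^sub>R norm x)"
        by (intro u(2)) simp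
      also have "\<dots> = ?f x / (norm x)\<^sup>2"
        by (simp add: matrix_vector_mult_scaleR power2_eq_square divide_inverse mult.commute)
      finally show ?thesis using False by (simp add: field_simps)
    qed simp
  qed
qed

text \<open>The equation \<open>(1 - Y)\<^sup>2 = 1 - X\<close> is the fixed point equation
  \<open>Y = (X + Y\<^sup>2) / 2\<close>. Its right-hand side is a contraction of the closed set of
  self-adjoint operators of norm at most \<open>r\<close>, so Banach's theorem gives
  \<open>Y\<close>.\<close>

lemma blinfun_square_root_near_identity:
  fixes X :: "'a::{real_inner,banach} \<Rightarrow>\<^sub>L 'a"
  assumes r: "norm X \<le> r" "r < 1" and sym: "\<And>x y. blinfun_apply X x \<bullet> y = x \<bullet> blinfun_apply X y"
  obtains Y :: "'a \<Rightarrow>\<^sub>L 'a" where "norm Y \<le> r" "\<And>x y. blinfun_apply Y x \<bullet> y = x \<bullet> blinfun_apply Y y"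
    "\<And>x. (x - blinfun_apply Y x) - blinfun_apply Y (x - blinfun_apply Y x) = x - blinfun_apply X x"
proof -
  let ?S = "{Y :: 'a \<Rightarrow>\<^sub>L 'a. norm Y \<le> r \<and> (\<forall>x y. blinfun_apply Y x \<bullet> y = x \<bullet> blinfun_apply Y y)}"
  let ?f = "\<lambda>Y. (1/2) *\<^sub>R (X + (Y o\<^sub>L Y))"
  have r0: "0 \<le> r" using r(1) norm_ge_zero order_trans by blast
  have "?S = cball 0 r \<inter> (\<Inter>x y. {Y :: 'a \<Rightarrow>\<^sub>L 'a. blinfun_apply Y x \<bullet> y = x \<bullet> blinfun_apply Y y})" by auto
  moreover have "closed {Y :: 'a \<Rightarrow>\<^sub>L 'a. blinfun_apply Y x \<bullet> y = x \<bullet> blinfun_apply Y y}" for x y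
    by (intro closed_Collect_eq continuous_intros)
  ultimately have "closed ?S"
    by (simp add: closed_Int closed_INT)
  then have "complete ?S" by (simp add: complete_eq_closed)
  moreover have "?S \<noteq> {}" using r0 by (auto intro!: exI[of _ 0])
  moreover have "?f ` ?S \<subseteq> ?S"
  proof safe
    fix Y :: "'a \<Rightarrow>\<^sub>L 'a"
    assume Y: "norm Y \<le> r" "\<forall>x y. blinfun_apply Y x \<bullet> y = x \<bullet> blinfun_apply Y y"
    have "norm (Y o\<^sub>L Y) \<le> norm Y * norm Y" by (rule norm_blinfun_compose)
    also have "\<dots> \<le> r * 1" using Y(1) r(2) r0 by (intro mult_mono) auto
    finally have "norm (X + (Y o\<^sub>L Y)) \<le> 2 * r"
      using r(1) norm_triangle_ineq[of X "Y o\<^sub>L Y"] by linarith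
    then show "norm (?f Y) \<le> r" by simp
    show "(?f Y) x \<bullet> y = x \<bullet> (?f Y) y" for x y
      by (simp add: blinfun.bilinear_simps inner_add_left inner_add_right sym Y(2))
  qed
  moreover have "dist (?f Y) (?f Z) \<le> r * dist Y Z" if "Y \<in> ?S" "Z \<in> ?S" for Y Z
  proof -
    \<comment> \<open>Operators need not commute, so \<open>Y\<^sup>2 - Z\<^sup>2\<close> is
      telescoped as \<open>Y (Y - Z) + (Y - Z) Z\<close>. Both norms are at most \<open>r\<close>,
      and the factor 1/2 leaves the contraction constant \<open>r\<close>.\<close>
    have "?f Y - ?f Z = (1/2) *\<^sub>R ((Y o\<^sub>L (Y - Z)) + ((Y - Z) o\<^sub>L Z))"
      by (intro blinfun_eqI) (simp add: blinfun.bilinear_simps algebra_simps)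
    then have "dist (?f Y) (?f Z) = norm ((Y o\<^sub>L (Y - Z)) + ((Y - Z) o\<^sub>L Z)) / 2"
      by (simp add: dist_norm)
    also have "norm ((Y o\<^sub>L (Y - Z)) + ((Y - Z) o\<^sub>L Z)) \<le> norm Y * norm (Y - Z) + norm (Y - Z) * norm Z"
      by (meson add_mono norm_blinfun_compose norm_triangle_ineq order_trans)
    also have "\<dots> \<le> r * norm (Y - Z) + norm (Y - Z) * r"
      using that by (intro add_mono mult_mono) (auto intro: r0)
    finally show ?thesis by (simp add: dist_norm mult.commute)
  qed
  ultimately obtain Y where Y: "Y \<in> ?S" "?f Y = Y"
    using Banach_fix[of ?S r ?f] r0 r(2) by blast
  show thesis
  proof
    fix x
    have "2 *\<^sub>R blinfun_apply Y x = 2 *\<^sub>R (?f Y) x" using Y(2) by simp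
    then have "blinfun_apply Y x + blinfun_apply Y x = blinfun_apply X x + blinfun_apply Y (blinfun_apply Y x)" by (simp add: blinfun.bilinear_simps scaleR_2)
    then show "(x - blinfun_apply Y x) - blinfun_apply Y (x - blinfun_apply Y x) = x - blinfun_apply X x" by (simp add: blinfun.bilinear_simps algebra_simps)
  qed (use Y(1) in auto)
qed

text \<open>After division by a suitable \<open>c\<close> the matrix becomes \<open>1 - X\<close>
  with \<open>norm X < 1\<close>, whose root is \<open>1 - Y\<close>. Scaling back gives
  \<open>S = sqrt c (1 - Y)\<close>, which is positive definite because
  \<open>norm Y < 1\<close>.\<close>

lemma pos_def_square_root_exists:
  fixes M :: "real^'n^'n"
  assumes sym: "transpose M = M" and pd: "pos_def M"
  obtains S where "transpose S = S" "pos_def S" "S ** S = M"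
proof -
  obtain m where m: "0 < m" "\<And>x. m * (norm x)\<^sup>2 \<le> x \<bullet> (M *v x)"
    using pos_def_lower_bound[OF pd] by blast
  obtain K where K: "0 < K" "\<And>x. norm (M *v x) \<le> norm x * K"
    using bounded_linear.pos_bounded[OF matrix_vector_mul_bounded_linear] by blast
  \<comment> \<open>This \<open>c\<close> minimises the bound
    \<open>1 - 2 m / c + K\<^sup>2 / c\<^sup>2\<close> for the square of the norm of
    \<open>X\<close>. The minimum is \<open>1 - m / c\<close>, hence the choice of
    \<open>r\<close>.\<close>
  define c where "c = K\<^sup>2 / m"
  have c: "0 < c" using m K by (simp add: c_def)
  define r where "r = sqrt (1 - m / c)"
  \<comment> \<open>Any unit vector shows \<open>m \<le> K\<close>; this keeps the radicand in
    \<open>r\<close> nonnegative.\<close>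
  have "m * (norm (axis undefined 1 :: real^'n))\<^sup>2 \<le> norm (axis undefined 1 :: real^'n) * norm (M *v axis undefined 1)"
    using m(2) norm_cauchy_schwarz order_trans by blast
  also have "\<dots> \<le> K" using K(2)[of "axis undefined 1"] by (simp add: norm_axis_1)
  finally have "m \<le> K" by (simp add: norm_axis_1)
  then have "m * m \<le> K * K" using m(1) by (intro mult_mono) auto
  then have mc: "m / c \<le> 1" using m(1) K(1) by (simp add: c_def field_simps power2_eq_square)
  have r: "0 \<le> r" "r < 1" "r\<^sup>2 = 1 - m / c"
    using mc m(1) c by (auto simp: r_def real_sqrt_lt_1_iff)
  define X where "X = Blinfun (\<lambda>x. x - (1 / c) *\<^sub>R (M *v x))"
  have X: "X x = x - (1 / c) *\<^sub>R (M *v x)" for x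
    unfolding X_def by (subst bounded_linear_Blinfun_apply)
      (auto intro!: bounded_linear_intros matrix_vector_mul_bounded_linear)
  have "norm X \<le> r"
  proof (rule norm_blinfun_bound[OF r(1)])
    fix x
    have "(norm (X x))\<^sup>2 = (norm x)\<^sup>2 - 2 / c * (x \<bullet> (M *v x)) + (norm (M *v x))\<^sup>2 / c\<^sup>2"
      unfolding X power2_norm_eq_inner
      by (simp add: inner_diff_left inner_diff_right inner_commute power2_eq_square)
    also have "\<dots> \<le> (norm x)\<^sup>2 - 2 / c * (m * (norm x)\<^sup>2) + (norm x * K)\<^sup>2 / c\<^sup>2"
      using c K(1) by (intro add_mono diff_mono mult_left_mono divide_right_mono m(2) power_mono K(2)) auto
    also have "\<dots> = r\<^sup>2 * (norm x)\<^sup>2"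
      using m(1) K(1) unfolding r(3) c_def by (simp add: field_simps power2_eq_square)
    finally have "(norm (X x))\<^sup>2 \<le> (r * norm x)\<^sup>2" by (simp add: power_mult_distrib)
    then show "norm (X x) \<le> r * norm x"
      using r(1) by (simp add: power2_le_iff_abs_le)
  qed
  moreover have "X x \<bullet> y = x \<bullet> X y" for x y
    using inner_matrix_vector_transpose[of M x y] sym
    by (simp add: X inner_diff_left inner_diff_right)
  ultimately obtain Y :: "(real, 'n) vec \<Rightarrow>\<^sub>L (real, 'n) vec" where Y: "norm Y \<le> r" "\<And>x y. blinfun_apply Y x \<bullet> y = x \<bullet> blinfun_apply Y y"
    "\<And>x. (x - blinfun_apply Y x) - blinfun_apply Y (x - blinfun_apply Y x) = x - X x"
    using blinfun_square_root_near_identity r(2) by blast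
  define S where "S = matrix (\<lambda>x. sqrt c *\<^sub>R (x - Y x))"
  have "linear (\<lambda>x. sqrt c *\<^sub>R (x - Y x))"
    by (intro linear_compose_scale_right linear_compose_sub linear_ident bounded_linear.linear blinfun.bounded_linear_right)
  then have S: "S *v x = sqrt c *\<^sub>R (x - Y x)" for x
    by (simp add: S_def matrix_works)
  show thesis
  proof
    show "transpose S = S"
      by (intro symmetric_matrixI) (simp add: S inner_diff_left inner_diff_right Y(2))
    show "pos_def S"
      unfolding pos_def_def
    proof safe
      fix x :: "real^'n" assume "x \<noteq> 0"
      have "x \<bullet> Y x \<le> norm x * (r * norm x)"
        by (meson Y(1) norm_blinfun norm_cauchy_schwarz mult_left_mono mult_right_mono norm_ge_zero order_trans)
      also have "\<dots> < norm x * norm x"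
        using \<open>x \<noteq> 0\<close> r(2) by simp
      finally show "0 < x \<bullet> (S *v x)"
        using c by (simp add: S inner_diff_right dot_square_norm power2_eq_square)
    qed
    have "(S ** S) *v x = M *v x" for x
    proof -
      have "(S ** S) *v x = S *v (S *v x)" by (simp add: matrix_vector_mul_assoc)
      also have "\<dots> = sqrt c *\<^sub>R (sqrt c *\<^sub>R ((x - Y x) - Y (x - Y x)))"
        by (simp add: S blinfun.bilinear_simps algebra_simps)
      also have "\<dots> = c *\<^sub>R (x - X x)" using c by (simp only: Y(3)) simp
      also have "\<dots> = M *v x" using c by (simp add: X)
      finally show ?thesis .
    qed
    then show "S ** S = M" by (simp add: matrix_eq)
  qed
qed

text \<open>Justifies the definite description in \<open>msqrt\<close>: a positive definite root
  exists, and every semidefinite root coincides with it.\<close>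

lemma msqrt_pos_def:
  fixes M :: "real^'n^'n"
  assumes "transpose M = M" and "pos_def M"
  shows "transpose (msqrt M) = msqrt M" "pos_def (msqrt M)" "msqrt M ** msqrt M = M"
proof -
  obtain S where S: "transpose S = S" "pos_def S" "S ** S = M"
    using pos_def_square_root_exists[OF assms] by blast
  have psd: "pos_semidef S"
    using S(2) unfolding pos_semidef_def pos_def_def by (metis inner_zero_left less_eq_real_def)
  have "msqrt M = S"
    unfolding msqrt_def
  proof (rule the_equality)
    show "transpose S = S \<and> pos_semidef S \<and> S ** S = M" using S psd by simp
    show "T = S" if "transpose T = T \<and> pos_semidef T \<and> T ** T = M" for T
      using square_root_unique[of S T] S that by simp
  qed
  with S show "transpose (msqrt M) = msqrt M" "pos_def (msqrt M)" "msqrt M ** msqrt M = M" by auto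
qed

lemma pos_def_invertible:
  fixes M :: "real^'n^'n"
  assumes "pos_def M"
  shows "invertible M"
proof -
  have "x = 0" if "M *v x = 0" for x
    using assms that unfolding pos_def_def by (metis inner_zero_right less_irrefl)
  then show ?thesis
    using invertible_left_inverse matrix_left_invertible_ker by blast
qed

subsection \<open>Power series in the inverse variable\<close>

text \<open>Removing the constant term and multiplying by \<beta> gives a series of the same kind.
  Boundedness of this quotient yields the limit of \<open>f\<close>, and its own limit is the next
  coefficient.\<close>

lemma inverse_power_series_shift:
  assumes "inverse_power_series f c"
  shows "inverse_power_series (\<lambda>\<beta>. \<beta> *\<^sub>R (f \<beta> - c 0)) (\<lambda>n. c (Suc n))"
  unfolding inverse_power_series_def
proof (rule eventually_mono[OF eventually_conj[OF assms[unfolded inverse_power_series_def] eventually_gt_at_top[of 0]]])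
  fix \<beta> :: real
  assume "(\<lambda>n. (1 / \<beta>) ^ n *\<^sub>R c n) sums f \<beta> \<and> 0 < \<beta>"
  then have "(\<lambda>n. (1 / \<beta>) ^ Suc n *\<^sub>R c (Suc n)) sums (f \<beta> - c 0)" and "0 < \<beta>"
    using sums_split_initial_segment[of "\<lambda>n. (1 / \<beta>) ^ n *\<^sub>R c n" "f \<beta>" 1] by auto
  then have "(\<lambda>n. \<beta> *\<^sub>R ((1 / \<beta>) ^ Suc n *\<^sub>R c (Suc n))) sums (\<beta> *\<^sub>R (f \<beta> - c 0))"
    by (intro sums_scaleR_right)
  then show "(\<lambda>n. (1 / \<beta>) ^ n *\<^sub>R c (Suc n)) sums (\<beta> *\<^sub>R (f \<beta> - c 0))"
    using \<open>0 < \<beta>\<close> by simp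
qed

text \<open>Convergence at one point \<open>b\<close> bounds the terms there by some
  \<open>K\<close>. For arguments beyond \<open>2 * b\<close> the terms are then dominated by the
  geometric series with ratio 1/2.\<close>

lemma inverse_power_series_Bfun:
  fixes f :: "real \<Rightarrow> 'a::banach"
  assumes "inverse_power_series f c"
  shows "Bfun f at_top"
proof -
  obtain b where b: "0 < b" "\<And>\<beta>. b \<le> \<beta> \<Longrightarrow> (\<lambda>n. (1 / \<beta>) ^ n *\<^sub>R c n) sums f \<beta>"
    using assms unfolding inverse_power_series_def eventually_at_top_linorder
    by (metis linorder_linear max.bounded_iff max.cobounded2 max_less_iff_conj less_max_iff_disj zero_less_one)
  have "(\<lambda>n. (1 / b) ^ n *\<^sub>R c n) \<longlonglongrightarrow> 0"
    using b by (intro summable_LIMSEQ_zero sums_summable) auto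
  then have "Bseq (\<lambda>n. (1 / b) ^ n *\<^sub>R c n)"
    by (intro convergent_imp_Bseq convergentI)
  then obtain K where K: "0 < K" "\<And>n. norm ((1 / b) ^ n *\<^sub>R c n) \<le> K"
    by (auto simp: Bseq_def)
  have "norm (f \<beta>) \<le> 2 * K" if "2 * b \<le> \<beta>" for \<beta>
  proof -
    have sm: "(\<lambda>n. (1 / \<beta>) ^ n *\<^sub>R c n) sums f \<beta>" using b that by simp
    have "norm ((1 / \<beta>) ^ n *\<^sub>R c n) \<le> (1/2) ^ n * K" for n
    proof -
      have "norm ((1 / \<beta>) ^ n *\<^sub>R c n) = (b / \<beta>) ^ n * norm ((1 / b) ^ n *\<^sub>R c n)"
        using b(1) that by (simp add: power_divide)
      also have "\<dots> \<le> (1/2) ^ n * K"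
        using b(1) that K by (intro mult_mono power_mono) (auto simp: field_simps)
      finally show ?thesis .
    qed
    moreover have "(\<lambda>n. (1/2::real) ^ n * K) sums (2 * K)"
      using sums_mult2[OF geometric_sums[of "1/2::real"], of K] by simp
    ultimately show ?thesis
      using norm_suminf_le[of "\<lambda>n. (1 / \<beta>) ^ n *\<^sub>R c n" "\<lambda>n. (1/2) ^ n * K"] sm
      by (metis sums_summable sums_unique)
  qed
  then show ?thesis
    using K(1) by (intro BfunI[of _ "2 * K"]) (auto simp: eventually_at_top_linorder)
qed

lemma inverse_power_series_tendsto:
  fixes f :: "real \<Rightarrow> 'a::banach"
  assumes "inverse_power_series f c"
  shows "(f \<longlongrightarrow> c 0) at_top"
proof -
  have "Zfun (\<lambda>\<beta>::real. 1 / \<beta>) at_top"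
    using tendsto_divide_0[OF tendsto_const filterlim_at_top_imp_at_infinity[OF filterlim_ident], of 1]
    by (simp add: tendsto_Zfun_iff)
  then have "Zfun (\<lambda>\<beta>. (1 / \<beta>) *\<^sub>R (\<beta> *\<^sub>R (f \<beta> - c 0))) at_top"
    by (intro bounded_bilinear.Zfun_prod_Bfun[OF bounded_bilinear_scaleR]
        inverse_power_series_Bfun[OF inverse_power_series_shift[OF assms]])
  moreover have "\<forall>\<^sub>F \<beta> in at_top. (1 / \<beta>) *\<^sub>R (\<beta> *\<^sub>R (f \<beta> - c 0)) = f \<beta> - c 0"
    using eventually_gt_at_top[of 0] by eventually_elim simp
  ultimately have "((\<lambda>\<beta>. f \<beta> - c 0) \<longlongrightarrow> 0) at_top"
    using Lim_transform_eventually[of "\<lambda>\<beta>. (1 / \<beta>) *\<^sub>R (\<beta> *\<^sub>R (f \<beta> - c 0))" 0 at_top "\<lambda>\<beta>. f \<beta> - c 0"]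
    by (simp only: tendsto_Zfun_iff diff_zero)
  then show ?thesis
    by (rule LIM_zero_cancel)
qed

lemma inverse_power_series_tendsto_scaled:
  fixes f :: "real \<Rightarrow> 'a::banach"
  assumes "inverse_power_series f c" "c 0 = 0"
  shows "((\<lambda>\<beta>. \<beta> *\<^sub>R f \<beta>) \<longlongrightarrow> c 1) at_top"
  using inverse_power_series_tendsto[OF inverse_power_series_shift[OF assms(1)]] assms(2) by simp

subsection \<open>Geometric and algebraic multiplicity\<close>

lemma mat_vector_mult: "mat t *v x = t *s x"
  by (simp add: matrix_vector_mult_def mat_def vec_eq_iff if_distrib if_distribR cong: if_cong)

text \<open>A ring homomorphism commutes with the Leibniz expansion. It is needed for evaluation of
  polynomials at a point and for the embedding of constants.\<close>

lemma det_map_matrix: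
  fixes h :: "'a::comm_ring_1 \<Rightarrow> 'b::comm_ring_1" and A :: "'a^'n^'n"
  assumes h1: "h 1 = 1" and add: "\<And>x y. h (x + y) = h x + h y" and mult: "\<And>x y. h (x * y) = h x * h y"
  shows "det (map_matrix h A) = h (det A)"
proof -
  have h0: "h 0 = 0" using add[of 0 0] by simp
  have minus: "h (- x) = - h x" for x
    using add[of x "- x"] h0 by (simp add: eq_neg_iff_add_eq_0 add.commute)
  have sum: "h (sum f S) = (\<Sum>i\<in>S. h (f i))" for f :: "('n \<Rightarrow> 'n) \<Rightarrow> 'a" and S
    by (induction S rule: infinite_finite_induct) (auto simp: h0 add)
  have prod: "h (prod f S) = (\<Prod>i\<in>S. h (f i))" for f :: "'n \<Rightarrow> 'a" and S
    by (induction S rule: infinite_finite_induct) (auto simp: h1 mult)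
  have "h (of_int (sign p)) = of_int (sign p)" for p :: "'n \<Rightarrow> 'n"
    by (simp add: sign_def h1 minus)
  then show ?thesis
    by (simp add: det_def sum prod mult)
qed

lemma poly_charpoly: "poly (charpoly M) t = det (mat t - M)"
proof -
  have "poly (charpoly M) t =
      det (map_matrix (\<lambda>p. poly p t) (\<chi> i j. (if i = j then [:0, 1:] else 0) - [:M $ i $ j:]))"
    unfolding charpoly_def by (rule det_map_matrix[symmetric]) simp_all
  also have "map_matrix (\<lambda>p. poly p t) (\<chi> i j. (if i = j then [:0, 1:] else 0) - [:M $ i $ j:]) = mat t - M"
    by (simp add: vec_eq_iff mat_def)
  finally show ?thesis .
qed

text \<open>A real \<open>t\<close> above an operator bound of \<open>M\<close> is not an
  eigenvalue, so the polynomial does not vanish there. Being nonzero, it lets divisibility by a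
  power of \<open>[:- z, 1:]\<close> bound \<open>order\<close> from below.\<close>

lemma charpoly_nonzero:
  fixes M :: "complex^'n^'n"
  shows "charpoly M \<noteq> 0"
proof
  assume 0: "charpoly M = 0"
  obtain K where K: "\<And>x. norm (M *v x) \<le> norm x * K"
    using bounded_linear.bounded[OF matrix_vector_mul_bounded_linear] by blast
  define t where "t = complex_of_real (\<bar>K\<bar> + 1)"
  have "x = 0" if "(mat t - M) *v x = 0" for x
  proof (rule ccontr)
    assume "x \<noteq> 0"
    then have "M *v x = t *s x"
      using that by (simp add: matrix_vector_mult_diff_rdistrib mat_vector_mult)
    also have "\<dots> = (\<bar>K\<bar> + 1) *\<^sub>R x"
      unfolding vec_eq_iff vector_scaleR_component by (simp add: t_def scaleR_conv_of_real distrib_right)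
    finally have "M *v x = (\<bar>K\<bar> + 1) *\<^sub>R x" .
    then have "(\<bar>K\<bar> + 1) * norm x \<le> norm x * K"
      using K[of x] by simp
    moreover have "norm x * K < norm x * (\<bar>K\<bar> + 1)"
      using \<open>x \<noteq> 0\<close> by (intro mult_strict_left_mono) auto
    ultimately show False by (simp add: mult.commute)
  qed
  then have "det (mat t - M) \<noteq> 0"
    using matrix_left_invertible_ker invertible_left_inverse invertible_det_nz by blast
  then show False using poly_charpoly[of M t] 0 by simp
qed

text \<open>Linearity in one row, applied twice. The factor \<open>c\<close> will be the linear
  polynomial \<open>[:- z, 1:]\<close>.\<close>

lemma det_rows_scale:
  fixes A :: "'a::comm_ring_1^'n^'n"
  assumes "k \<noteq> l"
  shows "det (\<chi> i. if i = k \<or> i = l then c *s (A $ i) else A $ i) = c * c * det A"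
proof -
  have "(\<chi> i. if i = k \<or> i = l then c *s (A $ i) else A $ i)
      = (\<chi> i. if i = k then c *s (A $ i) else (\<chi> i. if i = l then c *s (A $ i) else A $ i) $ i)"
    by (simp add: vec_eq_iff)
  then have "det (\<chi> i. if i = k \<or> i = l then c *s (A $ i) else A $ i)
      = c * det (\<chi> i. if i = k then A $ i else (\<chi> i. if i = l then c *s (A $ i) else A $ i) $ i)"
    by (simp only: det_row_mul)
  also have "(\<chi> i. if i = k then A $ i else (\<chi> i. if i = l then c *s (A $ i) else A $ i) $ i)
      = (\<chi> i. if i = l then c *s (A $ i) else A $ i)"
    using assms by (simp add: vec_eq_iff)
  also have "det \<dots> = c * det (\<chi> i. if i = l then A $ i else A $ i)"
    by (simp only: det_row_mul)
  finally show ?thesis by (simp add: mult.assoc)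
qed

text \<open>Replacing columns \<open>k\<close> and \<open>l\<close> of the identity by the two eigenvectors gives an
  invertible \<open>P\<close> such that \<open>[:-z, 1:]\<close> divides two columns of \<open>(X - M) P\<close>.\<close>

lemma order_charpoly_ge_2:
  fixes M :: "complex^'n^'n"
  assumes v: "M *v v = z *s v" "v \<noteq> 0" and u: "M *v u = z *s u" "\<And>c. u \<noteq> c *s v"
  shows "2 \<le> order z (charpoly M)"
proof -
  obtain k where k: "v $ k \<noteq> 0" using v(2) by (auto simp: vec_eq_iff)
  \<comment> \<open>Subtracting a multiple of \<open>v\<close> clears coordinate \<open>k\<close>.
    The correction is again an eigenvector, and it has a nonzero coordinate \<open>l\<close>
    different from \<open>k\<close>.\<close>
  define u' where "u' = u - (u $ k / v $ k) *s v"
  have "u' \<noteq> 0" using u(2) by (simp add: u'_def)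
  then obtain l where l: "u' $ l \<noteq> 0" by (auto simp: vec_eq_iff)
  have u'k: "u' $ k = 0" using k by (simp add: u'_def)
  then have kl: "k \<noteq> l" using l by auto
  have Mu': "M *v u' = z *s u'"
    using u(1) v(1) by (simp add: u'_def matrix_vector_mult_diff_distrib vector_scalar_commute
        vector_ssub_ldistrib vector_smult_assoc mult.commute)
  define P :: "complex^'n^'n" where
    "P = (\<chi> i j. if j = k then v $ i else if j = l then u' $ i else if i = j then 1 else 0)"
  have "x = 0" if x: "P *v x = 0" for x
  proof -
    have P: "(P *v x) $ i = v $ i * x $ k + u' $ i * x $ l + (if i = k \<or> i = l then 0 else x $ i)" for i
    proof -
      have "(P *v x) $ i = (\<Sum>j\<in>UNIV. (if j = k then v $ i * x $ k else 0)
          + (if j = l then u' $ i * x $ l else 0) + (if j = i then if i = k \<or> i = l then 0 else x $ i else 0))"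
        unfolding matrix_vector_mult_def P_def using kl by (auto intro!: sum.cong)
      then show ?thesis by (simp add: sum.distrib)
    qed
    \<comment> \<open>The system is solved in the order \<open>k\<close>, \<open>l\<close>, rest:
      \<open>u' $ k = 0\<close> leaves only \<open>x $ k\<close> in row \<open>k\<close>, then row
      \<open>l\<close> leaves only \<open>x $ l\<close>, and every other row reduces to
      \<open>x $ i\<close>.\<close>
    have "x $ k = 0" using P[of k] x k u'k by simp
    moreover have "x $ l = 0" using P[of l] x l \<open>x $ k = 0\<close> by simp
    ultimately have "x $ i = 0" for i using P[of i] x by (cases "i = k \<or> i = l") auto
    then show ?thesis by (simp add: vec_eq_iff)
  qed
  then have detP: "det P \<noteq> 0"
    using matrix_left_invertible_ker invertible_left_inverse invertible_det_nz by blast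
  define C where "C = (\<chi> i j. (if i = j then [:0, 1:] else 0) - [:M $ i $ j:])"
  define Q where "Q = map_matrix (\<lambda>c. [:c:]) P"
  \<comment> \<open>The rows of \<open>E\<close> are the columns of \<open>C ** Q\<close> with the
    factor \<open>[:- z, 1:]\<close> removed at \<open>k\<close> and \<open>l\<close>; transposing
    makes the row rule for determinants applicable.\<close>
  define E where "E = (\<chi> j. if j = k \<or> j = l then column j Q else column j (C ** Q))"
  have col: "column j (C ** Q) = [:- z, 1:] *s column j Q" if "j = k \<or> j = l" for j
  proof -
    have "M *v column j P = z *s column j P"
      using that v(1) Mu' kl by (auto simp: column_def P_def)
    then have M: "(\<Sum>m\<in>UNIV. M $ i $ m * P $ m $ j) = z * P $ i $ j" for i
      by (simp add: vec_eq_iff matrix_vector_mult_def column_def)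
    have "(C ** Q) $ i $ j = [:- z, 1:] * Q $ i $ j" for i
    proof -
      have "(C ** Q) $ i $ j = (\<Sum>m\<in>UNIV. (if m = i then [:0, 1:] * [:P $ i $ j:] else 0) - [:M $ i $ m * P $ m $ j:])"
        unfolding matrix_matrix_mult_def C_def Q_def
        by (auto intro!: sum.cong simp: algebra_simps)
      also have "\<dots> = [:0, 1:] * [:P $ i $ j:] - [:\<Sum>m\<in>UNIV. M $ i $ m * P $ m $ j:]"
      proof -
        have "(\<Sum>m\<in>S. [:f m:]) = [:sum f S:]" for f :: "'n \<Rightarrow> complex" and S
          by (induction S rule: infinite_finite_induct) auto
        then show ?thesis by (simp add: sum_subtractf)
      qed
      also have "\<dots> = [:- z, 1:] * Q $ i $ j"
        by (simp add: M Q_def)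
      finally show ?thesis .
    qed
    then show ?thesis by (simp add: column_def vec_eq_iff)
  qed
  have "charpoly M * det Q = det (transpose (C ** Q))"
    by (simp add: charpoly_def C_def det_mul det_transpose)
  also have "transpose (C ** Q) = (\<chi> j. if j = k \<or> j = l then [:- z, 1:] *s (E $ j) else E $ j)"
  proof -
    have "transpose (C ** Q) $ j = column j (C ** Q)" for j
      by (simp add: transpose_def column_def)
    then show ?thesis
      by (subst vec_eq_iff) (auto simp: E_def col)
  qed
  also have "det \<dots> = [:- z, 1:] ^ 2 * det E"
    by (simp add: det_rows_scale[OF kl] power2_eq_square)
  also have "det Q = [:det P:]"
    unfolding Q_def by (rule det_map_matrix) simp_all
  finally have "smult (det P) (charpoly M) = [:- z, 1:] ^ 2 * det E"
    by (simp add: mult.commute)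
  \<comment> \<open>\<open>det P\<close> is a nonzero constant, hence a unit, and does not affect
    divisibility.\<close>
  then have "[:- z, 1:] ^ 2 dvd charpoly M"
    using detP by (metis dvd_smult_cancel dvd_triv_left)
  then show ?thesis
    using charpoly_nonzero[of M] by (simp add: order_divides)
qed

subsection \<open>The block eigenvalue problem\<close>

lemma complexify_mult: "complexify (A ** B) = complexify A ** complexify B"
  by (simp add: complexify_def matrix_matrix_mult_def vec_eq_iff)

lemma complexify_one: "complexify (mat 1) = mat 1"
  by (simp add: complexify_def mat_def vec_eq_iff)

lemma matrix_inv_inverse:
  assumes "invertible A"
  shows "A ** matrix_inv A = mat 1" "matrix_inv A ** A = mat 1"
  using assms someI_ex[of "\<lambda>A'. A ** A' = mat 1 \<and> A' ** A = mat 1"]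
  unfolding invertible_def matrix_inv_def by blast+

lemma symmetric_matrix_inv:
  fixes A :: "'a::comm_ring_1^'n^'n"
  assumes "invertible A" "transpose A = A"
  shows "transpose (matrix_inv A) = matrix_inv A"
proof -
  have "transpose (matrix_inv A) ** A = transpose (A ** matrix_inv A)"
    by (simp add: matrix_transpose_mul assms(2))
  also have "\<dots> = mat 1"
    by (simp add: matrix_inv_inverse assms(1) transpose_mat)
  finally have "transpose (matrix_inv A) ** (A ** matrix_inv A) = matrix_inv A"
    by (simp add: matrix_mul_assoc)
  then show ?thesis
    by (simp add: matrix_inv_inverse assms(1))
qed

lemma complexify_inverse:
  assumes "invertible A"
  shows "complexify (matrix_inv A) ** complexify A = mat 1"
    and "complexify A ** complexify (matrix_inv A) = mat 1"
  using matrix_inv_inverse[OF assms] by (simp_all add: complexify_mult[symmetric] complexify_one)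

lemma cmat_scale_vector_mult: "cmat_scale c A *v x = c *s (A *v x)"
  by (simp add: cmat_scale_def matrix_vector_mult_def vec_eq_iff sum_distrib_left mult.assoc)

definition upper :: "'a^('n + 'n) \<Rightarrow> 'a^'n" where
  "upper w = (\<chi> i. w $ Inl i)"

definition lower :: "'a^('n + 'n) \<Rightarrow> 'a^'n" where
  "lower w = (\<chi> i. w $ Inr i)"

lemma block_matrix_vector_mult:
  fixes w :: "'a::semiring_1^('n::finite + 'n)"
  shows "upper (block_matrix P Q S T *v w) = P *v upper w + Q *v lower w"
    and "lower (block_matrix P Q S T *v w) = S *v upper w + T *v lower w"
  by (simp_all add: upper_def lower_def block_matrix_def matrix_vector_mult_def vec_eq_iff
      UNIV_sum[symmetric] sum.Plus UNIV_Plus_UNIV[symmetric] del: UNIV_Plus_UNIV)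

lemma upper_lower_linear:
  fixes u v :: "'a::ring_1^('n::finite + 'n)"
  shows "upper (u - c *s v) = upper u - c *s upper v" "lower (u - c *s v) = lower u - c *s lower v"
  by (simp_all add: upper_def lower_def vec_eq_iff)

text \<open>Reads off the two block rows. The premise \<open>tr\<close> replaces the transposed
  coupling by \<open>a\<close> after \<open>s\<close>, so that \<open>a\<close> can be cancelled
  from the second row in the limit.\<close>

lemma A_mat_eigenvector:
  assumes "A_mat \<alpha> \<eta> \<theta> R \<beta> *v w = z *s w"
  defines "a \<equiv> complexify (matrix_inv (msqrt \<alpha>))" and "s \<equiv> complexify (msqrt \<eta>)"
  assumes tr: "transpose (Phi_mat \<alpha> \<eta>) = matrix_inv (msqrt \<alpha>) ** msqrt \<eta>"
  shows "z *s lower w = \<i> *s (s *v (a *v upper w))"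
    and "z *s upper w = (- 2 * \<i>) *s (a *v (complexify \<theta> *v (a *v upper w))) - \<i> *s (a *v (s *v lower w))
      - (\<i> * complex_of_real \<beta>) *s (a *v (complexify R *v (a *v upper w)))"
proof -
  have *: "z *s w = Omega_mat \<alpha> \<eta> \<theta> *v w - (\<i> * complex_of_real \<beta>) *s (B_mat \<alpha> R *v w)"
    using assms(1) by (simp add: A_mat_def matrix_vector_mult_diff_rdistrib cmat_scale_vector_mult)
  have "z *s lower w = lower (z *s w)" "z *s upper w = upper (z *s w)"
    by (simp_all add: lower_def upper_def vec_eq_iff)
  then show "z *s lower w = \<i> *s (s *v (a *v upper w))"
    and "z *s upper w = (- 2 * \<i>) *s (a *v (complexify \<theta> *v (a *v upper w))) - \<i> *s (a *v (s *v lower w))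
      - (\<i> * complex_of_real \<beta>) *s (a *v (complexify R *v (a *v upper w)))"
    unfolding *
    by (simp_all add: Omega_mat_def tr upper_lower_linear B_mat_def block_matrix_vector_mult
        cmat_scale_vector_mult a_def s_def complexify_mult matrix_vector_mul_assoc matrix_mul_assoc)
      (simp_all add: Phi_mat_def complexify_mult matrix_vector_mul_assoc vec_eq_iff)
qed

text \<open>Every block is \<i> times a real matrix, so conjugating the entries changes the sign of
  the matrix. Conjugating the eigenvalue equation therefore gives the reflected one.\<close>

lemma A_mat_eigenvalue_reflect:
  fixes w :: "complex^('n::finite + 'n)"
  assumes "A_mat \<alpha> \<eta> \<theta> R \<beta> *v w = z *s w"
  shows "A_mat \<alpha> \<eta> \<theta> R \<beta> *v (\<chi> i. cnj (w $ i)) = (- cnj z) *s (\<chi> i. cnj (w $ i))"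
proof -
  let ?A = "A_mat \<alpha> \<eta> \<theta> R \<beta>"
  have "cnj (?A $ i $ j) = - ?A $ i $ j" for i j
    by (cases i; cases j)
      (simp_all add: A_mat_def Omega_mat_def B_mat_def block_matrix_def cmat_scale_def complexify_def)
  then have A: "?A $ i $ j = - cnj (?A $ i $ j)" for i j
    by simp
  have "(\<Sum>j\<in>UNIV. ?A $ i $ j * cnj (w $ j)) = - cnj (z * w $ i)" for i
  proof -
    have "(\<Sum>j\<in>UNIV. ?A $ i $ j * cnj (w $ j)) = - cnj (\<Sum>j\<in>UNIV. ?A $ i $ j * w $ j)"
      by (subst A) (simp add: sum_negf)
    also have "(\<Sum>j\<in>UNIV. ?A $ i $ j * w $ j) = z * w $ i"
      using assms by (simp add: vec_eq_iff matrix_vector_mult_def)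
    finally show ?thesis .
  qed
  then show ?thesis
    by (simp add: vec_eq_iff matrix_vector_mult_def)
qed

text \<open>If \<open>z\<close> differed from all \<open>\<zeta> k\<close>, then
  \<open>A - mat z\<close> would scale each basis vector by a nonzero number. It would be
  surjective, hence injective, and could not annihilate \<open>v\<close>.\<close>

lemma eigenvalue_in_eigenbasis:
  fixes A :: "complex^'n^'n"
  assumes basis: "basis_family I w" and eig: "\<And>j. j \<in> I \<Longrightarrow> A *v w j = \<zeta> j *s w j"
    and v: "A *v v = z *s v" "v \<noteq> 0"
  shows "\<exists>k\<in>I. \<zeta> k = z"
proof (rule ccontr)
  assume no: "\<not> (\<exists>k\<in>I. \<zeta> k = z)"
  define L where "L = A - mat z"
  have L: "L *v x = A *v x - z *s x" for x
    by (simp add: L_def matrix_vector_mult_diff_rdistrib mat_vector_mult)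
  have "w k \<in> range ((*v) L)" if "k \<in> I" for k
  proof -
    have ne: "\<zeta> k - z \<noteq> 0" using no that by auto
    have "L *v w k = (\<zeta> k - z) *s w k"
      by (simp add: L eig[OF that])
    then have "L *v ((1 / (\<zeta> k - z)) *s w k) = (1 / (\<zeta> k - z)) *s ((\<zeta> k - z) *s w k)"
      by (simp only: vector_scalar_commute)
    also have "\<dots> = w k"
      using ne by (simp only: vector_smult_assoc) simp
    finally have "L *v ((1 / (\<zeta> k - z)) *s w k) = w k" .
    then show ?thesis by (metis rangeI)
  qed
  moreover have "vec.subspace (range ((*v) L))"
    by (auto simp: vec.subspace_def image_def) (metis matrix_vector_mult_0_right, metis matrix_vector_right_distrib,
      metis vector_scalar_commute)
  ultimately have "vec.span (w ` I) \<subseteq> range ((*v) L)"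
    by (intro vec.span_minimal) auto
  then have "surj ((*v) L)"
    using basis by (auto simp: basis_family_def)
  then have "inj ((*v) L)"
    by (intro vec.linear_surjective_imp_injective matrix_vector_mul_linear_gen refl)
  moreover have "L *v v = L *v 0" using v(1) by (simp add: L)
  ultimately show False using v(2) by (metis injD)
qed

lemma tendsto_matrix_vector_mult [tendsto_intros]:
  fixes A :: "complex^'n^'m"
  assumes "(f \<longlongrightarrow> l) F"
  shows "((\<lambda>x. A *v f x) \<longlongrightarrow> A *v l) F"
  unfolding matrix_vector_mult_def
  by (intro vec_tendstoI) (auto intro!: tendsto_intros assms)

lemma tendsto_vector_scalar_mult [tendsto_intros]:
  fixes f :: "'a \<Rightarrow> complex^'n"
  assumes "(c \<longlongrightarrow> d) F" "(f \<longlongrightarrow> l) F"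
  shows "((\<lambda>x. c x *s f x) \<longlongrightarrow> d *s l) F"
  by (intro vec_tendstoI) (auto intro!: tendsto_intros assms)

text \<open>The first equation turns \<open>\<beta> *s (a *v x \<beta>)\<close> into a multiple of \<open>y \<beta>\<close>, so it stays bounded
  and the second equation has a limit.\<close>

lemma block_eigenvector_limit:
  fixes s s' a a' T R :: "complex^'n^'n" and x y :: "real \<Rightarrow> complex^'n" and z :: "real \<Rightarrow> complex"
  assumes low: "\<forall>\<^sub>F \<beta> in at_top. z \<beta> *s y \<beta> = \<i> *s (s *v (a *v x \<beta>))"
    and up: "\<forall>\<^sub>F \<beta> in at_top. z \<beta> *s x \<beta> = (- 2 * \<i>) *s (a *v (T *v (a *v x \<beta>)))
      - \<i> *s (a *v (s *v y \<beta>)) - (\<i> * complex_of_real \<beta>) *s (a *v (R *v (a *v x \<beta>)))"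
    and inv: "s' ** s = mat 1" "a' ** a = mat 1"
    and lim: "(x \<longlongrightarrow> x0) at_top" "(y \<longlongrightarrow> y0) at_top" "(z \<longlongrightarrow> 0) at_top"
      "((\<lambda>\<beta>. complex_of_real \<beta> * z \<beta>) \<longlongrightarrow> - \<i> * c) at_top"
  shows "x0 = 0" and "s *v y0 = c *s (R *v (s' *v y0))"
proof -
  have s': "s' *v (s *v v) = v" and a': "a' *v (a *v v) = v" for v
    by (simp_all add: matrix_vector_mul_assoc inv)
  \<comment> \<open>In the first equation \<open>z\<close> tends to 0 while \<open>y\<close>
    converges, so \<open>s *v (a *v x0) = 0\<close>; the left inverses of \<open>s\<close> and
    \<open>a\<close> give \<open>x0 = 0\<close>.\<close>
  have "((\<lambda>\<beta>. z \<beta> *s y \<beta>) \<longlongrightarrow> \<i> *s (s *v (a *v x0))) at_top"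
    by (rule Lim_transform_eventually[OF _ eventually_mono[OF low]])
      (auto intro!: tendsto_intros lim)
  moreover have "((\<lambda>\<beta>. z \<beta> *s y \<beta>) \<longlongrightarrow> 0 *s y0) at_top"
    by (intro tendsto_intros lim)
  ultimately have "\<i> *s (s *v (a *v x0)) = 0"
    using tendsto_unique[OF trivial_limit_at_top_linorder] by fastforce
  then have "s *v (a *v x0) = 0" by simp
  then show x0: "x0 = 0" by (metis s' a' matrix_vector_mult_0_right)
  have ax: "\<forall>\<^sub>F \<beta> in at_top. complex_of_real \<beta> *s (a *v x \<beta>) = (- \<i>) *s ((complex_of_real \<beta> * z \<beta>) *s (s' *v y \<beta>))"
    using low
  proof eventually_elim
    case (elim \<beta>)
    have "a *v x \<beta> = (- \<i>) *s (s' *v (\<i> *s (s *v (a *v x \<beta>))))"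
      by (simp add: vector_scalar_commute s')
    then show ?case
      by (simp add: elim[symmetric] vector_scalar_commute mult.commute mult.left_commute)
  qed
  have "((\<lambda>\<beta>. (- \<i>) *s ((complex_of_real \<beta> * z \<beta>) *s (s' *v y \<beta>))) \<longlongrightarrow> (- \<i>) *s ((- \<i> * c) *s (s' *v y0))) at_top"
    by (intro tendsto_intros lim)
  then have "((\<lambda>\<beta>. complex_of_real \<beta> *s (a *v x \<beta>)) \<longlongrightarrow> (- \<i>) *s ((- \<i> * c) *s (s' *v y0))) at_top"
    by (rule Lim_transform_eventually) (use ax in eventually_elim, simp)
  then have ax_lim: "((\<lambda>\<beta>. complex_of_real \<beta> *s (a *v x \<beta>)) \<longlongrightarrow> (- c) *s (s' *v y0)) at_top"
    by simp
  \<comment> \<open>The factor \<beta> of the loss term is moved onto \<open>a *v x \<beta>\<close>,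
    where the limit is known. The left side \<open>z \<beta> *s x \<beta>\<close> tends to 0, and
    the \<open>T\<close> term vanishes since \<open>x0 = 0\<close>.\<close>
  have "((\<lambda>\<beta>. (- 2 * \<i>) *s (a *v (T *v (a *v x \<beta>))) - \<i> *s (a *v (s *v y \<beta>))
      - \<i> *s (a *v (R *v (complex_of_real \<beta> *s (a *v x \<beta>))))) \<longlongrightarrow>
      (- 2 * \<i>) *s (a *v (T *v (a *v x0))) - \<i> *s (a *v (s *v y0))
      - \<i> *s (a *v (R *v ((- c) *s (s' *v y0))))) at_top"
    by (intro tendsto_intros lim ax_lim)
  then have "((\<lambda>\<beta>. z \<beta> *s x \<beta>) \<longlongrightarrow> (- 2 * \<i>) *s (a *v (T *v (a *v x0))) - \<i> *s (a *v (s *v y0))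
      - \<i> *s (a *v (R *v ((- c) *s (s' *v y0))))) at_top"
    by (rule Lim_transform_eventually[OF _ eventually_mono[OF up]])
      (simp add: vector_scalar_commute)
  moreover have "((\<lambda>\<beta>. z \<beta> *s x \<beta>) \<longlongrightarrow> 0 *s x0) at_top"
    by (intro tendsto_intros lim)
  ultimately have "(- 2 * \<i>) *s (a *v (T *v (a *v x0))) - \<i> *s (a *v (s *v y0))
      - \<i> *s (a *v (R *v ((- c) *s (s' *v y0)))) = 0 *s x0"
    by (rule tendsto_unique[OF trivial_limit_at_top_linorder])
  moreover have "a *v (R *v ((- c) *s (s' *v y0))) = - (a *v (c *s (R *v (s' *v y0))))"
    by (simp only: vector_scalar_commute) (simp only: vector_smult_lneg)
  ultimately have "\<i> *s (a *v (c *s (R *v (s' *v y0)) - s *v y0)) = 0"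
    by (simp add: x0 matrix_vector_mult_diff_distrib vec_eq_iff algebra_simps)
  then have "a *v (c *s (R *v (s' *v y0)) - s *v y0) = 0" by simp
  then have "c *s (R *v (s' *v y0)) - s *v y0 = 0" by (metis a' matrix_vector_mult_0_right)
  then show "s *v y0 = c *s (R *v (s' *v y0))" by simp
qed

text \<open>A real weight \<open>g\<close> commutes with conjugation, and \<open>- cnj l = l\<close>
  says that \<open>l\<close> is purely imaginary. The reflected branch thus has the same weighted
  limit \<open>l\<close>, which separates it from \<open>h\<close>. The weight selects the scale of
  comparison: 1/\<beta>, 1 or \<beta>.\<close>

lemma eventually_reflection_neq:
  assumes "((\<lambda>\<beta>. complex_of_real (g \<beta>) * f \<beta>) \<longlongrightarrow> l) F" "((\<lambda>\<beta>. complex_of_real (g \<beta>) * h \<beta>) \<longlongrightarrow> l') F"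
    and "- cnj l = l" "l \<noteq> l'"
  shows "\<forall>\<^sub>F \<beta> in F. - cnj (f \<beta>) \<noteq> h \<beta>"
proof -
  have "((\<lambda>\<beta>. - cnj (complex_of_real (g \<beta>) * f \<beta>)) \<longlongrightarrow> - cnj l) F"
    by (intro tendsto_intros assms)
  then have "((\<lambda>\<beta>. - cnj (complex_of_real (g \<beta>) * f \<beta>) - complex_of_real (g \<beta>) * h \<beta>) \<longlongrightarrow> l - l') F"
    unfolding assms(3) by (intro tendsto_diff assms)
  then have "\<forall>\<^sub>F \<beta> in F. - cnj (complex_of_real (g \<beta>) * f \<beta>) - complex_of_real (g \<beta>) * h \<beta> \<noteq> 0"
    using assms(4) by (intro tendsto_imp_eventually_ne) auto
  then show ?thesis
  proof eventually_elim
    case (elim \<beta>)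
    show ?case
    proof
      assume eq: "- cnj (f \<beta>) = h \<beta>"
      show False using elim by (simp flip: eq)
    qed
  qed
qed

theorem corollary42:
  fixes \<alpha> \<eta> \<theta> R :: "real^'n^'n"
    and b b_flat \<rho> d :: "nat \<Rightarrow> real"
    and w0 :: "nat \<Rightarrow> complex^('n + 'n)"
    and w :: "nat \<Rightarrow> real \<Rightarrow> complex^('n + 'n)"
    and \<zeta> :: "nat \<Rightarrow> real \<Rightarrow> complex"
  assumes "transpose \<alpha> = \<alpha>" and "pos_def \<alpha>"
    and "transpose \<eta> = \<eta>" and "pos_def \<eta>"
    and "transpose \<theta> = - \<theta>"
    and "transpose R = R" and "pos_semidef R" and "rank R > 0"
    and "nonzero_eigenvalues (matrix_inv \<alpha> ** R) (rank R) b"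
    and "\<forall>j\<in>{1..rank R}. 0 < b j" and "mono_on {1..rank R} b"
    and "inj_on b {1..rank R}"
    and "nonzero_eigenvalues (matrix_inv \<eta> ** R) (rank R) b_flat"
    and "inj_on b_flat {1..rank R}"
    and "loss_eigensystem \<alpha> \<eta> \<theta> R b \<rho> d w0 w \<zeta>"
    and "\<forall>j\<in>{rank R + 1..2 * rank R}. \<rho> j = 0"
    and "\<forall>j\<in>{2 * rank R + 1..2 * CARD('n)}. \<rho> j \<noteq> 0"
  shows "\<forall>\<^sub>F \<beta> in at_top.
           (\<forall>j\<in>{1..rank R}. Re (\<zeta> j \<beta>) = 0) \<and>
           (\<forall>j\<in>{rank R + 1..2 * rank R}. Re (\<zeta> j \<beta>) = 0) \<and>
           (\<forall>j\<in>{2 * rank R + 1..2 * CARD('n)}. Re (\<zeta> j \<beta>) \<noteq> 0)"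
proof -

  \<comment> \<open>Leading behaviour of the branches\<close>
  note sym_\<alpha> = assms(1) and pd_\<alpha> = assms(2) and sym_\<eta> = assms(3) and pd_\<eta> = assms(4)
  let ?r = "rank R" and ?N = "2 * CARD('n)"
  note es = assms(15)[unfolded loss_eigensystem_def]
  have inner_w0: "hinner (w0 j) (w0 k) = (if j = k then 1 else 0)" if "j \<in> {1..?N}" "k \<in> {1..?N}" for j k
    using es that by (auto simp: orthonormal_basis_def)
  have eig: "\<forall>\<^sub>F \<beta> in at_top. basis_family {1..?N} (\<lambda>j. w j \<beta>) \<and>
      (\<forall>j\<in>{1..?N}. A_mat \<alpha> \<eta> \<theta> R \<beta> *v w j \<beta> = \<zeta> j \<beta> *s w j \<beta>)"
    using es by blast
  have "?r \<le> CARD('n)" by (rule rank_bound[THEN order_trans]) simp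
  then have sub: "{1..?r} \<subseteq> {1..?N}" "{?r + 1..2 * ?r} \<subseteq> {1..?N}" "{2 * ?r + 1..?N} \<subseteq> {1..?N}"
      "{?r + 1..2 * ?r} \<subseteq> {?r + 1..?N}" "{2 * ?r + 1..?N} \<subseteq> {?r + 1..?N}"
    by auto
  have split: "{1..?N} = {1..?r} \<union> {?r + 1..2 * ?r} \<union> {2 * ?r + 1..?N}"
    using \<open>?r \<le> CARD('n)\<close> by auto
  have w_lim: "(w j \<longlongrightarrow> w0 j) at_top" if "j \<in> {1..?N}" for j
    using es that inverse_power_series_tendsto by metis
  have low_lim: "(\<zeta> j \<longlongrightarrow> complex_of_real (\<rho> j)) at_top" if "j \<in> {?r + 1..?N}" for j
    using es that inverse_power_series_tendsto by metis
  have mid_lim: "((\<lambda>\<beta>. complex_of_real \<beta> * \<zeta> j \<beta>) \<longlongrightarrow> - \<i> * complex_of_real (d j)) at_top"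
    if "j \<in> {?r + 1..2 * ?r}" for j
  proof -
    have jl: "j \<in> {?r + 1..?N}" using that sub(4) by blast
    obtain c where c: "inverse_power_series (\<zeta> j) c" "c 0 = complex_of_real (\<rho> j)" "c 1 = - \<i> * complex_of_real (d j)"
      using es jl by blast
    moreover have "\<rho> j = 0" using assms(16) that by blast
    \<comment> \<open>With zero constant coefficient, multiplication by \<beta> exposes the next
      one.\<close>
    ultimately show ?thesis
      using inverse_power_series_tendsto_scaled[OF c(1)] by (simp add: scaleR_conv_of_real)
  qed
  have inv_lim: "((\<lambda>\<beta>. complex_of_real (1 / \<beta>)) \<longlongrightarrow> 0) at_top"
    using tendsto_of_real[where 'a=complex, OF tendsto_divide_0[OF tendsto_const filterlim_at_top_imp_at_infinity[OF filterlim_ident]], of 1]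
    by (simp only: of_real_0)
  have high_lim: "((\<lambda>\<beta>. complex_of_real (1 / \<beta>) * \<zeta> j \<beta>) \<longlongrightarrow> - \<i> * complex_of_real (b j)) at_top"
    if j: "j \<in> {1..?r}" for j
  proof -
    obtain c where c: "inverse_power_series (\<lambda>\<beta>. \<zeta> j \<beta> + \<i> * complex_of_real (b j * \<beta>)) c"
      using es j by blast
    have "((\<lambda>\<beta>. complex_of_real (1 / \<beta>) * (\<zeta> j \<beta> + \<i> * complex_of_real (b j * \<beta>)) - \<i> * complex_of_real (b j))
        \<longlongrightarrow> 0 * c 0 - \<i> * complex_of_real (b j)) at_top"
      by (intro tendsto_intros inv_lim inverse_power_series_tendsto[OF c])
    then have "((\<lambda>\<beta>. complex_of_real (1 / \<beta>) * \<zeta> j \<beta>) \<longlongrightarrow> 0 * c 0 - \<i> * complex_of_real (b j)) at_top"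
    proof (rule Lim_transform_eventually)
      show "\<forall>\<^sub>F \<beta> in at_top. complex_of_real (1 / \<beta>) * (\<zeta> j \<beta> + \<i> * complex_of_real (b j * \<beta>)) - \<i> * complex_of_real (b j)
          = complex_of_real (1 / \<beta>) * \<zeta> j \<beta>"
        using eventually_gt_at_top[of 0] by eventually_elim (simp add: field_simps)
    qed
    then show ?thesis by simp
  qed
  \<comment> \<open>Low-loss branches are bounded and so vanish at the scale on which the high-loss
    branches tend to nonzero limits.\<close>
  have low_lim': "((\<lambda>\<beta>. complex_of_real (1 / \<beta>) * \<zeta> j \<beta>) \<longlongrightarrow> 0) at_top" if "j \<in> {?r + 1..?N}" for j
    using tendsto_mult[OF inv_lim low_lim[OF that]] by simp

  \<comment> \<open>Distinctness of the low-loss damping coefficients\<close>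
  define s where "s = complexify (msqrt \<eta>)"
  define s' where "s' = complexify (matrix_inv (msqrt \<eta>))"
  note sq_\<alpha> = msqrt_pos_def[OF sym_\<alpha> pd_\<alpha>] and sq_\<eta> = msqrt_pos_def[OF sym_\<eta> pd_\<eta>]
  have inv_\<eta>: "invertible (msqrt \<eta>)" and inv_\<alpha>: "invertible (msqrt \<alpha>)"
    using sq_\<alpha>(2) sq_\<eta>(2) pos_def_invertible by auto
  have s: "s' ** s = mat 1" "s ** s' = mat 1"
    using complexify_inverse[OF inv_\<eta>] by (auto simp: s_def s'_def)
  have \<eta>: "complexify \<eta> = s ** s"
    by (simp add: s_def complexify_mult[symmetric] sq_\<eta>(3))
  have tr: "transpose (Phi_mat \<alpha> \<eta>) = matrix_inv (msqrt \<alpha>) ** msqrt \<eta>"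
    by (simp add: Phi_mat_def matrix_transpose_mul sq_\<eta>(1) symmetric_matrix_inv inv_\<alpha> sq_\<alpha>(1))
  have mid: "upper (w0 j) = 0 \<and>
      s *v lower (w0 j) = complex_of_real (d j) *s (complexify R *v (s' *v lower (w0 j)))"
    if j: "j \<in> {?r + 1..2 * ?r}" for j
  proof -
    have jN: "j \<in> {1..?N}" and jl: "j \<in> {?r + 1..?N}" using j sub by blast+
    have up_lim: "((\<lambda>\<beta>. upper (w j \<beta>)) \<longlongrightarrow> upper (w0 j)) at_top"
      and lo_lim: "((\<lambda>\<beta>. lower (w j \<beta>)) \<longlongrightarrow> lower (w0 j)) at_top"
      unfolding upper_def lower_def by (intro vec_tendstoI; simp; intro tendsto_vec_nth w_lim jN)+
    have z: "(\<zeta> j \<longlongrightarrow> 0) at_top" using low_lim[OF jl] assms(16) j by simp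
    have ev: "\<forall>\<^sub>F \<beta> in at_top. A_mat \<alpha> \<eta> \<theta> R \<beta> *v w j \<beta> = \<zeta> j \<beta> *s w j \<beta>"
      using eig by eventually_elim (use jN in blast)
    show ?thesis
      using block_eigenvector_limit[OF eventually_mono[OF ev A_mat_eigenvector(1)[OF _ tr]]
          eventually_mono[OF ev A_mat_eigenvector(2)[OF _ tr]] _ _ up_lim lo_lim z mid_lim[OF j]]
        s(1) complexify_inverse(2)[OF inv_\<alpha>] by (simp add: s_def s'_def)
  qed
  have d_inj: "d j \<noteq> d k" if j: "j \<in> {?r + 1..2 * ?r}" and k: "k \<in> {?r + 1..2 * ?r}" and "j \<noteq> k" for j k
  proof
    assume dd: "d j = d k"
    have s': "s *v (s' *v v) = v" for v by (simp add: matrix_vector_mul_assoc s)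
    \<comment> \<open>Substituting \<open>lower (w0 i) = s *v q i\<close> turns the limit equation
      into the generalised eigenvalue equation of \<eta> and \<open>R\<close>.\<close>
    define q where "q i = s' *v lower (w0 i)" for i
    have eq_q: "complexify \<eta> *v q i = complex_of_real (d i) *s (complexify R *v q i)"
      if "i \<in> {?r + 1..2 * ?r}" for i
      using mid[OF that] by (simp add: \<eta> q_def matrix_vector_mul_assoc[symmetric] s')
    have not_mult: "w0 k \<noteq> c *s w0 j" for c
    proof
      assume w0: "w0 k = c *s w0 j"
      have "hinner (w0 j) (w0 k) = c * hinner (w0 j) (w0 j)"
        unfolding w0 hinner_def by (simp add: sum_distrib_left mult_ac)
      then have "c = 0" using inner_w0[of j k] inner_w0[of j j] j k \<open>j \<noteq> k\<close> sub by auto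
      then have "hinner (w0 k) (w0 k) = 0" by (simp add: w0 hinner_def)
      then show False using inner_w0[of k k] k sub by auto
    qed
    \<comment> \<open>The upper halves are zero and \<open>s\<close> recovers the lower halves, so
      proportionality of the \<open>q\<close> would pass to the orthonormal vectors
      \<open>w0\<close>.\<close>
    have w0_eqI: "w0 k = c *s w0 i" if "q k = c *s q i" "i \<in> {?r + 1..2 * ?r}" for c i
    proof -
      have "lower (w0 k) = s *v q k" by (simp add: q_def s')
      also have "\<dots> = c *s lower (w0 i)" by (simp add: that(1) vector_scalar_commute) (simp add: q_def s')
      finally have lo: "lower (w0 k) = c *s lower (w0 i)" .
      have up: "upper (w0 k) = c *s upper (w0 i)" using mid k that(2) by simp
      show ?thesis
        unfolding vec_eq_iff
      proof
        fix m show "w0 k $ m = (c *s w0 i) $ m"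
          using lo up by (cases m) (auto simp: lower_def upper_def vec_eq_iff)
      qed
    qed
    have q_indep: "q k \<noteq> c *s q j" for c using w0_eqI not_mult j by blast
    have qj0: "q j \<noteq> 0"
    proof
      assume "q j = 0"
      then have "s *v q j = 0" by simp
      then have "lower (w0 j) = 0" by (simp add: q_def s')
      moreover have "upper (w0 j) = 0" using mid j by simp
      ultimately have "w0 j $ m = 0" for m
        by (cases m) (auto simp: lower_def upper_def vec_eq_iff)
      then have "hinner (w0 j) (w0 j) = 0" by (simp add: hinner_def)
      then show False using inner_w0[of j j] j sub by auto
    qed
    note e = complexify_inverse[OF pos_def_invertible[OF pd_\<eta>]]
    have qi: "q i = complex_of_real (d i) *s (complexify (matrix_inv \<eta> ** R) *v q i)"
      if "i \<in> {?r + 1..2 * ?r}" for i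
    proof -
      have "q i = complexify (matrix_inv \<eta>) *v (complexify \<eta> *v q i)"
        by (simp add: matrix_vector_mul_assoc e)
      also have "\<dots> = complex_of_real (d i) *s (complexify (matrix_inv \<eta> ** R) *v q i)"
        by (simp add: eq_q[OF that] vector_scalar_commute complexify_mult matrix_vector_mul_assoc)
      finally show ?thesis .
    qed
    \<comment> \<open>A zero coefficient would force \<open>q j = 0\<close>; the quotient
      \<open>1 / d j\<close> is therefore a genuine nonzero eigenvalue.\<close>
    then have "d j \<noteq> 0" using qj0 j by fastforce
    define z where "z = complex_of_real (1 / d j)"
    have "z \<noteq> 0" using \<open>d j \<noteq> 0\<close> by (simp add: z_def)
    have eigq: "complexify (matrix_inv \<eta> ** R) *v q i = z *s q i"
      if "i \<in> {?r + 1..2 * ?r}" "d i = d j" for i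
      by (subst (2) qi[OF that(1)]) (simp add: z_def that(2) vector_smult_assoc \<open>d j \<noteq> 0\<close>)
    have "2 \<le> order z (charpoly (complexify (matrix_inv \<eta> ** R)))"
      using eigq j k dd qj0 q_indep by (intro order_charpoly_ge_2[of _ "q j" _ "q k"]) auto
    \<comment> \<open>The nonzero \<open>z\<close> occurs among the \<open>b_flat\<close> values as
      often as its algebraic multiplicity, while injectivity allows one occurrence.\<close>
    also have "\<dots> = card {i \<in> {1..?r}. complex_of_real (b_flat i) = z}"
      using assms(13) \<open>z \<noteq> 0\<close> by (simp add: nonzero_eigenvalues_def)
    also have "\<dots> \<le> Suc 0"
    proof (subst card_le_Suc0_iff_eq; safe?)
      fix i l assume "i \<in> {1..?r}" "l \<in> {1..?r}"
        and "z = complex_of_real (b_flat i)" "complex_of_real (b_flat l) = complex_of_real (b_flat i)"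
      with assms(14) show "i = l" by (metis inj_onD of_real_eq_iff)
    qed simp
    finally show False by simp
  qed

  \<comment> \<open>Reflection of the spectrum and real parts\<close>
  have self: "\<forall>\<^sub>F \<beta> in at_top. Re (\<zeta> j \<beta>) = 0"
    if j: "j \<in> {1..?N}" and ne: "\<And>k. k \<in> {1..?N} \<Longrightarrow> k \<noteq> j \<Longrightarrow> \<forall>\<^sub>F \<beta> in at_top. - cnj (\<zeta> j \<beta>) \<noteq> \<zeta> k \<beta>" for j
  proof -
    have "\<forall>\<^sub>F \<beta> in at_top. \<forall>k\<in>{1..?N} - {j}. - cnj (\<zeta> j \<beta>) \<noteq> \<zeta> k \<beta>"
      using ne by (intro eventually_ball_finite) auto
    with eig show ?thesis
    proof eventually_elim
      case (elim \<beta>)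
      then have basis: "basis_family {1..?N} (\<lambda>j. w j \<beta>)"
        and e: "\<And>i. i \<in> {1..?N} \<Longrightarrow> A_mat \<alpha> \<eta> \<theta> R \<beta> *v w i \<beta> = \<zeta> i \<beta> *s w i \<beta>" by auto
      have "w j \<beta> \<noteq> 0"
        using basis j vec.dependent_zero[of "(\<lambda>j. w j \<beta>) ` {1..?N}"]
        unfolding basis_family_def by (metis imageI)
      then have "(\<chi> i. cnj (w j \<beta> $ i)) \<noteq> 0" by (simp add: vec_eq_iff)
      \<comment> \<open>The reflected eigenvalue must be among the listed ones. All indices other
        than \<open>j\<close> are excluded, so the branch is its own reflection.\<close>
      then obtain k where "k \<in> {1..?N}" "\<zeta> k \<beta> = - cnj (\<zeta> j \<beta>)"
        using eigenvalue_in_eigenbasis[OF basis e A_mat_eigenvalue_reflect[OF e[OF j]]] by blast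
      then have "\<zeta> j \<beta> = - cnj (\<zeta> j \<beta>)" using elim(2) by (metis DiffI singletonD)
      then show ?case by (auto simp: complex_eq_iff)
    qed
  qed

  have high: "\<forall>\<^sub>F \<beta> in at_top. Re (\<zeta> j \<beta>) = 0" if j: "j \<in> {1..?r}" for j
  proof (rule self)
    fix k assume k: "k \<in> {1..?N}" "k \<noteq> j"
    \<comment> \<open>After division by \<beta> the limits are \<open>- \<i> * b k\<close> for
      high-loss \<open>k\<close> and 0 for low-loss \<open>k\<close>; both differ from
      \<open>- \<i> * b j\<close> because the \<open>b\<close> are distinct and positive.\<close>
    obtain l where l: "((\<lambda>\<beta>. complex_of_real (1 / \<beta>) * \<zeta> k \<beta>) \<longlongrightarrow> l) at_top" "- \<i> * complex_of_real (b j) \<noteq> l"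
    proof (cases "k \<in> {1..?r}")
      case True
      then have "b j \<noteq> b k" using assms(12) j k by (auto dest: inj_onD)
      with that[OF high_lim[OF True]] show thesis by simp
    next
      case False
      moreover have "b j > 0" using assms(10) j by simp
      ultimately show thesis using that[OF low_lim'[of k]] k by auto
    qed
    show "\<forall>\<^sub>F \<beta> in at_top. - cnj (\<zeta> j \<beta>) \<noteq> \<zeta> k \<beta>"
      by (rule eventually_reflection_neq[OF high_lim[OF j] l(1) _ l(2)]) simp
  qed (use j sub in blast)

  have middle: "\<forall>\<^sub>F \<beta> in at_top. Re (\<zeta> j \<beta>) = 0" if j: "j \<in> {?r + 1..2 * ?r}" for j
  proof (rule self)
    have jl: "j \<in> {?r + 1..?N}" using j sub by blast
    have z: "(\<zeta> j \<longlongrightarrow> 0) at_top" using low_lim[OF jl] assms(16) j by simp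
    fix k assume k: "k \<in> {1..?N}" "k \<noteq> j"
    then consider "k \<in> {1..?r}" | "k \<in> {?r + 1..2 * ?r}" | "k \<in> {2 * ?r + 1..?N}" using split by blast
    then show "\<forall>\<^sub>F \<beta> in at_top. - cnj (\<zeta> j \<beta>) \<noteq> \<zeta> k \<beta>"
    \<comment> \<open>Each class of competitors needs its own weight: 1/\<beta> against high-loss
      branches (0 versus \<open>- \<i> * b k\<close>), \<beta> against branches with
      \<open>\<rho> k = 0\<close> (\<open>- \<i> * d j\<close> versus \<open>- \<i> * d k\<close>),
      and 1 against the others (0 versus \<open>\<rho> k\<close>).\<close>
    proof cases
      case 1
      have "b k > 0" using assms(10) 1 by simp
      then show ?thesis
        by (intro eventually_reflection_neq[OF low_lim'[OF jl] high_lim[OF 1]]) auto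
    next
      case 2
      show ?thesis
        using d_inj[OF j 2] k
        by (intro eventually_reflection_neq[OF mid_lim[OF j] mid_lim[OF 2]]) auto
    next
      case 3
      then have "(\<zeta> k \<longlongrightarrow> complex_of_real (\<rho> k)) at_top" using low_lim sub by blast
      moreover have "\<rho> k \<noteq> 0" using assms(17) 3 by simp
      ultimately show ?thesis
        using z by (intro eventually_reflection_neq[of "\<lambda>_. 1" _ 0 _ _ "complex_of_real (\<rho> k)"]) auto
    qed
  qed (use j sub in blast)

  have rest: "\<forall>\<^sub>F \<beta> in at_top. Re (\<zeta> j \<beta>) \<noteq> 0" if j: "j \<in> {2 * ?r + 1..?N}" for j
  proof (rule tendsto_imp_eventually_ne)
    show "((\<lambda>\<beta>. Re (\<zeta> j \<beta>)) \<longlongrightarrow> \<rho> j) at_top"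
      using tendsto_Re[OF low_lim[of j]] j sub by auto
    show "\<rho> j \<noteq> 0" using assms(17) j by simp
  qed

  show ?thesis
    using high middle rest by (intro eventually_conj eventually_ball_finite) auto
qed

end
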